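(* Let $S$ and $T$ be posets. Let $\{e_s\}_{s\in S}$, $\{f_t\}_{t \in T}$ and $\{g_{s,t}\}_{(s,t)\in S\times T}$ be the natural bases (indicator functions of points) of $\mathrm{Lex}(S)$, $\mathrm{Lex}(T)$ and $\mathrm{Lex}(S\times T)$. Then the natural linear map $\mathrm{Lex}(S) \otimes \mathrm{Lex}(T) \to \mathrm{Lex}(S \times T)$ determined by $e_s \otimes f_t \mapsto g_{s,t}$ is a linear isomorphism, and under this isomorphism the projective cone $K_p = K_p(\mathrm{Lex}(S),\mathrm{Lex}(T)) \subset \mathrm{Lex}(S)\otimes \mathrm{Lex}(T)$ is mapped onto $\mathrm{Lex}(S \times T)_+$.
   Context: All vector spaces are real. For a poset (partially ordered set) $S$, let $F_0(S)$ be the vector space of finitely supported functions $f\colon S \to \mathbb{R}$. $\mathrm{Lex}(S)$ denotes $F_0(S)$ equipped with the cone $$\mathrm{Lex}(S)_+ = \{f \in F_0(S) \colon \text{for every } s \in S,\ f(s) < 0 \text{ implies that there exists } t<s \text{ with } f(t) > 0\}.$$ The indicator functions $e_s\colon t \mapsto \delta_{st}$, $s \in S$, form a basis of $\mathrm{Lex}(S)$. The product $S \times T$ carries the product order: $(s_1,t_1) \le (s_2,t_2)$ iff $s_1 \le s_2$ and $t_1 \le t_2$. For ordered vector spaces $X$ and $Y$ with positive cones $X_+$, $Y_+$, the projective cone in the algebraic tensor product $X\otimes Y$ is $$K_p(X,Y) = \left\{ \sum_{i=1}^n x_i \otimes y_i \colon n \in \mathbb{N},\ x_i \in X_+,\ y_i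 \in Y_+ \right\}.$$ *)

theory Defs
  imports "HOL-Analysis.Finite_Function_Topology" "HOL-Library.Product_Order"
begin

section \<open>The algebraic tensor product of real vector spaces\<close>

text \<open>
  The free vector space on the set of pairs, modulo the subspace generated by the bilinearity
  relations.
\<close>

definition tensor_relators :: "('a::real_vector \<times> 'b::real_vector \<Rightarrow>\<^sub>0 real) set" where
  "tensor_relators =
     {Poly_Mapping.single (x + x', y) 1 - Poly_Mapping.single (x, y) 1
        - Poly_Mapping.single (x', y) 1 | x x' y. True} \<union>
     {Poly_Mapping.single (x, y + y') 1 - Poly_Mapping.single (x, y) 1
        - Poly_Mapping.single (x, y') 1 | x y y'. True} \<union>
     {Poly_Mapping.single (c *\<^sub>R x, y) 1 - c *\<^sub>R Poly_Mapping.single (x, y) 1 | c x y. True} \<union>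
     {Poly_Mapping.single (x, c *\<^sub>R y) 1 - c *\<^sub>R Poly_Mapping.single (x, y) 1 | c x y. True}"

definition tensor_rel ::
  "('a::real_vector \<times> 'b::real_vector \<Rightarrow>\<^sub>0 real) \<Rightarrow> ('a \<times> 'b \<Rightarrow>\<^sub>0 real) \<Rightarrow> bool" where
  "tensor_rel u v \<longleftrightarrow> u - v \<in> span tensor_relators"

lemma equivp_tensor_rel: "equivp tensor_rel"
proof (rule equivpI)
  show "reflp tensor_rel"
    by (auto simp: reflp_def tensor_rel_def span_zero)
  show "symp tensor_rel"
    unfolding symp_def tensor_rel_def by (auto dest: span_neg)
  show "transp tensor_rel"
    unfolding transp_def tensor_rel_def by (auto dest: span_add)
qed

quotient_type (overloaded) ('a, 'b) tensor = "('a::real_vector \<times> 'b::real_vector) \<Rightarrow>\<^sub>0 real" / tensor_rel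
  by (rule equivp_tensor_rel)

instantiation tensor :: (real_vector, real_vector) real_vector
begin

lift_definition zero_tensor :: "('a, 'b) tensor" is 0 .

lift_definition plus_tensor :: "('a, 'b) tensor \<Rightarrow> ('a, 'b) tensor \<Rightarrow> ('a, 'b) tensor" is "(+)"
  unfolding tensor_rel_def by (simp add: add_diff_add span_add)

lift_definition minus_tensor :: "('a, 'b) tensor \<Rightarrow> ('a, 'b) tensor \<Rightarrow> ('a, 'b) tensor" is "(-)"
  unfolding tensor_rel_def by (drule (1) span_diff) (simp add: algebra_simps)

lift_definition uminus_tensor :: "('a, 'b) tensor \<Rightarrow> ('a, 'b) tensor" is uminus
  unfolding tensor_rel_def by (drule span_neg) (simp add: algebra_simps)

lift_definition scaleR_tensor :: "real \<Rightarrow> ('a, 'b) tensor \<Rightarrow> ('a, 'b) tensor" is scaleR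
  unfolding tensor_rel_def by (simp add: span_scale flip: scaleR_diff_right)

instance
  by standard (transfer; simp add: tensor_rel_def span_zero algebra_simps)+

end

lift_definition pure_tensor :: "'a::real_vector \<Rightarrow> 'b::real_vector \<Rightarrow> ('a, 'b) tensor"
    (infixl "\<otimes>" 75)
  is "\<lambda>x y. Poly_Mapping.single (x, y) 1" .

text \<open>
  For subspaces \<open>V\<close> and \<open>W\<close> the tensor product is realised inside the tensor product of the ambient
  spaces.  Lemma \<open>tensor_space_universal\<close> below shows that it has the universal property of the
  tensor product of \<open>V\<close> and \<open>W\<close> in their own right; for \<open>V = UNIV\<close> and \<open>W = UNIV\<close> it is the whole
  type (\<open>tensor_space_UNIV\<close>).
\<close>

definition tensor_space ::
  "'a::real_vector set \<Rightarrow> 'b::real_vector set \<Rightarrow> ('a, 'b) tensor set" where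
  "tensor_space V W = span {x \<otimes> y | x y. x \<in> V \<and> y \<in> W}"

definition linear_map_on ::
  "'a::real_vector set \<Rightarrow> ('a \<Rightarrow> 'b::real_vector) \<Rightarrow> bool" where
  "linear_map_on V f \<longleftrightarrow>
     (\<forall>x\<in>V. \<forall>y\<in>V. f (x + y) = f x + f y) \<and> (\<forall>c. \<forall>x\<in>V. f (c *\<^sub>R x) = c *\<^sub>R f x)"

definition projective_cone ::
  "'a::real_vector set \<Rightarrow> 'b::real_vector set \<Rightarrow> ('a, 'b) tensor set" where
  "projective_cone C D =
     {\<Sum>i<n. x i \<otimes> y i | (n::nat) x y. (\<forall>i<n. x i \<in> C) \<and> (\<forall>i<n. y i \<in> D)}"

section \<open>Lexicographic cones\<close>

text \<open>
  A poset is a set \<open>S\<close>, possibly empty, of elements of a partially ordered type, with the induced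
  order.  Functions on \<open>S\<close> are represented by their extension by zero.
\<close>

definition F0 :: "'s set \<Rightarrow> ('s \<Rightarrow>\<^sub>0 real) set" where
  "F0 S = {f. Poly_Mapping.keys f \<subseteq> S}"

definition Lex_cone :: "'s::order set \<Rightarrow> ('s \<Rightarrow>\<^sub>0 real) set" where
  "Lex_cone S =
     {f \<in> F0 S. \<forall>s\<in>S. Poly_Mapping.lookup f s < 0 \<longrightarrow>
        (\<exists>t\<in>S. t < s \<and> Poly_Mapping.lookup f t > 0)}"

section \<open>Basic properties\<close>

lemma lookup_scaleR_poly_mapping:
  "Poly_Mapping.lookup (c *\<^sub>R f) k = c *\<^sub>R Poly_Mapping.lookup (f :: 'k \<Rightarrow>\<^sub>0 'v::real_vector) k"
proof -
  have "finite {i. c *\<^sub>R Poly_Mapping.lookup f i \<noteq> 0}"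
    by (rule finite_subset[OF _ finite_keys[of f]]) (auto simp: in_keys_iff)
  then show ?thesis
    by (simp add: scaleR_poly_mapping_def)
qed

lemma F0_iff: "f \<in> F0 S \<longleftrightarrow> (\<forall>k. k \<notin> S \<longrightarrow> Poly_Mapping.lookup f k = 0)"
  by (auto simp: F0_def in_keys_iff)

lemma subspace_F0: "subspace (F0 S)"
  by (simp add: subspace_def F0_iff lookup_add lookup_scaleR_poly_mapping)

lemma pure_tensor_add_left: "(x + x') \<otimes> y = x \<otimes> y + x' \<otimes> y"
  by transfer (unfold tensor_rel_def diff_diff_eq[symmetric],
      rule span_base, unfold tensor_relators_def, blast)

lemma pure_tensor_add_right: "x \<otimes> (y + y') = x \<otimes> y + x \<otimes> y'"
  by transfer (unfold tensor_rel_def diff_diff_eq[symmetric],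
      rule span_base, unfold tensor_relators_def, blast)

lemma pure_tensor_scaleR_left: "(c *\<^sub>R x) \<otimes> y = c *\<^sub>R (x \<otimes> y)"
  by transfer (unfold tensor_rel_def, rule span_base, unfold tensor_relators_def, blast)

lemma pure_tensor_scaleR_right: "x \<otimes> (c *\<^sub>R y) = c *\<^sub>R (x \<otimes> y)"
  by transfer (unfold tensor_rel_def, rule span_base, unfold tensor_relators_def, blast)

lemma abs_tensor_surj: "\<exists>u. z = abs_tensor u"
  by (induct z rule: tensor.abs_induct) auto

lemma tensor_space_UNIV: "tensor_space (UNIV :: 'a::real_vector set) (UNIV :: 'b::real_vector set) = UNIV"
proof -
  have "abs_tensor u \<in> tensor_space UNIV UNIV" for u :: "'a \<times> 'b \<Rightarrow>\<^sub>0 real"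
  proof (induction u rule: update_induct)
    case const
    then show ?case
      by (simp add: tensor_space_def span_zero flip: zero_tensor.abs_eq)
  next
    case (update u k c)
    obtain x y where k: "k = (x, y)"
      by (cases k)
    have "Poly_Mapping.update k c u = u + c *\<^sub>R Poly_Mapping.single k 1"
      using update(1) by (intro poly_mapping_eqI)
        (auto simp: lookup_add lookup_scaleR_poly_mapping lookup_single lookup_update in_keys_iff)
    then have "abs_tensor (Poly_Mapping.update k c u) = abs_tensor u + c *\<^sub>R (x \<otimes> y)"
      by (simp add: k plus_tensor.abs_eq scaleR_tensor.abs_eq pure_tensor.abs_eq)
    then show ?case
      using update(3) unfolding tensor_space_def
      by (auto intro!: span_add span_scale intro: span_base)
  qed
  then show ?thesis
    by (metis UNIV_eq_I abs_tensor_surj)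
qed

definition free_extend :: "('k \<Rightarrow> 'c) \<Rightarrow> ('k \<Rightarrow>\<^sub>0 real) \<Rightarrow> 'c::real_vector" where
  "free_extend b u = (\<Sum>k\<in>Poly_Mapping.keys u. Poly_Mapping.lookup u k *\<^sub>R b k)"

lemma free_extend_superset:
  assumes "finite A" "Poly_Mapping.keys u \<subseteq> A"
  shows "free_extend b u = (\<Sum>k\<in>A. Poly_Mapping.lookup u k *\<^sub>R b k)"
  unfolding free_extend_def
  by (rule sum.mono_neutral_left) (use assms in \<open>auto simp: in_keys_iff\<close>)

lemma linear_free_extend: "linear (free_extend b)"
proof (rule linearI)
  fix u v :: "'a \<Rightarrow>\<^sub>0 real"
  let ?A = "Poly_Mapping.keys u \<union> Poly_Mapping.keys v"
  have "Poly_Mapping.keys (u + v) \<subseteq> ?A"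
    by (rule Poly_Mapping.keys_add)
  then show "free_extend b (u + v) = free_extend b u + free_extend b v"
    by (simp add: free_extend_superset[of ?A] lookup_add scaleR_add_left sum.distrib)
next
  fix c and u :: "'a \<Rightarrow>\<^sub>0 real"
  have "Poly_Mapping.keys (c *\<^sub>R u) \<subseteq> Poly_Mapping.keys u"
    by (auto simp: in_keys_iff lookup_scaleR_poly_mapping)
  then show "free_extend b (c *\<^sub>R u) = c *\<^sub>R free_extend b u"
    by (simp add: free_extend_superset[of "Poly_Mapping.keys u"] lookup_scaleR_poly_mapping
        scaleR_sum_right)
qed

lemma free_extend_single: "free_extend b (Poly_Mapping.single k 1) = b k"
  by (simp add: free_extend_def)

lemma tensor_universal:
  fixes b :: "'a::real_vector \<Rightarrow> 'b::real_vector \<Rightarrow> 'c::real_vector"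
  assumes l: "\<And>y. linear (\<lambda>x. b x y)" and r: "\<And>x. linear (b x)"
  shows "\<exists>h. linear h \<and> (\<forall>x y. h (x \<otimes> y) = b x y)"
proof -
  let ?H = "free_extend (\<lambda>(x, y). b x y)"
  note H = linear_free_extend[of "\<lambda>(x, y). b x y"]
  have ker: "?H w = 0" if "w \<in> span tensor_relators" for w
    using that
  proof (rule span_induct[where P = "\<lambda>w. ?H w = 0", unfolded mem_Collect_eq])
    show "subspace {w. ?H w = 0}"
      by (rule linear_subspace_kernel[OF H])
  next
    fix w :: "'a \<times> 'b \<Rightarrow>\<^sub>0 real" assume "w \<in> tensor_relators"
    then show "?H w = 0"
      by (auto simp: tensor_relators_def linear_diff[OF H] linear_scale[OF H] free_extend_single
          linear_add[OF l] linear_add[OF r] linear_scale[OF l] linear_scale[OF r])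
  qed
  define h where "h z = ?H (rep_tensor z)" for z
  have abs: "h (abs_tensor u) = ?H u" for u
  proof -
    have "tensor_rel (rep_tensor (abs_tensor u)) u"
      using Quotient3_tensor by (metis Quotient3_abs_rep tensor.abs_eq_iff)
    then show ?thesis
      using ker[of "rep_tensor (abs_tensor u) - u"]
      by (simp add: tensor_rel_def h_def linear_diff[OF H])
  qed
  have "linear h"
  proof (rule linearI)
    fix z z' :: "('a, 'b) tensor"
    obtain u u' where "z = abs_tensor u" "z' = abs_tensor u'"
      using abs_tensor_surj by metis
    then show "h (z + z') = h z + h z'"
      by (simp add: plus_tensor.abs_eq abs linear_add[OF H])
  next
    fix c and z :: "('a, 'b) tensor"
    obtain u where "z = abs_tensor u"
      using abs_tensor_surj by metis
    then show "h (c *\<^sub>R z) = c *\<^sub>R h z"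
      by (simp add: scaleR_tensor.abs_eq abs linear_scale[OF H])
  qed
  moreover have "h (x \<otimes> y) = b x y" for x y
    by (simp add: pure_tensor.abs_eq abs free_extend_single)
  ultimately show ?thesis
    by blast
qed

lemma tensor_space_universal:
  fixes b :: "'a::real_vector \<Rightarrow> 'b::real_vector \<Rightarrow> 'c::real_vector"
  assumes V: "subspace V" and W: "subspace W"
    and l: "\<And>y. y \<in> W \<Longrightarrow> linear_map_on V (\<lambda>x. b x y)"
    and r: "\<And>x. x \<in> V \<Longrightarrow> linear_map_on W (b x)"
  shows "\<exists>h. linear_map_on (tensor_space V W) h \<and> (\<forall>x\<in>V. \<forall>y\<in>W. h (x \<otimes> y) = b x y) \<and>
    (\<forall>h'. linear_map_on (tensor_space V W) h' \<and> (\<forall>x\<in>V. \<forall>y\<in>W. h' (x \<otimes> y) = b x y)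
       \<longrightarrow> (\<forall>z\<in>tensor_space V W. h' z = h z))"
proof -
  obtain P where P: "range P \<subseteq> V" "linear P" "\<And>v. v \<in> V \<Longrightarrow> P v = v"
    using linear_exists_left_inverse_on[OF linear_id V] by auto
  obtain Q where Q: "range Q \<subseteq> W" "linear Q" "\<And>v. v \<in> W \<Longrightarrow> Q v = v"
    using linear_exists_left_inverse_on[OF linear_id W] by auto
  have PV: "P x \<in> V" and QW: "Q y \<in> W" for x y
    using P Q by auto
  have "linear (\<lambda>x. b (P x) (Q y))" for y
    using l[OF QW] PV by (auto intro!: linearI simp: linear_map_on_def linear_add[OF P(2)] linear_scale[OF P(2)])
  moreover have "linear (\<lambda>y. b (P x) (Q y))" for x
    using r[OF PV] QW by (auto intro!: linearI simp: linear_map_on_def linear_add[OF Q(2)] linear_scale[OF Q(2)])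
  ultimately have "\<exists>h. linear h \<and> (\<forall>x y. h (x \<otimes> y) = b (P x) (Q y))"
    by (rule tensor_universal)
  then obtain h where h: "linear h" "\<And>x y. h (x \<otimes> y) = b (P x) (Q y)"
    by blast
  have uniq: "h' z = h z"
    if h': "linear_map_on (tensor_space V W) h'" "\<forall>x\<in>V. \<forall>y\<in>W. h' (x \<otimes> y) = b x y"
      and z: "z \<in> tensor_space V W" for h' z
  proof -
    have "h' (0 *\<^sub>R 0) = 0 *\<^sub>R h' 0"
      using h'(1) span_zero unfolding linear_map_on_def tensor_space_def by blast
    then have zero: "h' 0 = 0"
      by simp
    have "z \<in> tensor_space V W \<and> h' z = h z"
      using z unfolding tensor_space_def
    proof (induction rule: span_induct_alt)
      case base
      then show ?case by (simp add: span_zero zero linear_0[OF h(1)])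
    next
      case (step c x y)
      have "x \<in> span {x \<otimes> y |x y. x \<in> V \<and> y \<in> W}"
        using step by (auto intro: span_base)
      moreover have "h' x = h x"
        using step h'(2) by (auto simp: h(2) P(3) Q(3))
      ultimately show ?case
        using step(2) h'(1) unfolding linear_map_on_def tensor_space_def
        by (simp add: span_add span_scale linear_add[OF h(1)] linear_scale[OF h(1)])
    qed
    then show ?thesis ..
  qed
  have "linear_map_on (tensor_space V W) h"
    by (simp add: linear_map_on_def linear_add[OF h(1)] linear_scale[OF h(1)])
  moreover have "\<forall>x\<in>V. \<forall>y\<in>W. h (x \<otimes> y) = b x y"
    by (simp add: h(2) P(3) Q(3))
  ultimately show ?thesis
    using uniq by blast
qed

end

theory Submission
  imports Defs
begin

text \<open>
  The isomorphism sends \<open>x \<otimes> y\<close> to the function \<open>(s, t) \<mapsto> x s * y t\<close>.  It preserves positivity: if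
  \<open>x s * y t < 0\<close> then a positive value below the negative factor, multiplied by the positive
  factor, is a positive value below \<open>(s, t)\<close>.  Sums stay positive because a minimal point of the
  joint support below a negative value of the sum carries no negative summand.

  Conversely, a lexicographic cone is generated by the \<open>a *\<^sub>R e\<^sub>s\<close> and the \<open>a *\<^sub>R e\<^sub>t - b *\<^sub>R e\<^sub>s\<close> with
  \<open>t < s\<close> and \<open>a, b > 0\<close>.  On the product, a generator for \<open>(s', t') < (s, t)\<close> with
  \<open>s' < s\<close> is reached through the corner \<open>(s, t')\<close>:
  \<open>a *\<^sub>R g\<^bsub>s',t'\<^esub> - b *\<^sub>R g\<^bsub>s,t\<^esub> = (a *\<^sub>R e\<^bsub>s'\<^esub> - b *\<^sub>R e\<^sub>s) \<otimes> f\<^bsub>t'\<^esub> + e\<^sub>s \<otimes> (b *\<^sub>R f\<^bsub>t'\<^esub> - b *\<^sub>R f\<^sub>t)\<close>;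
  if \<open>s' = s\<close>, it is itself a tensor \<open>e\<^sub>s \<otimes> (a *\<^sub>R f\<^bsub>t'\<^esub> - b *\<^sub>R f\<^sub>t)\<close>.
\<close>

section \<open>Linear maps on finitely supported functions\<close>

lemma scaleR_single: "c *\<^sub>R Poly_Mapping.single k (a :: real) = Poly_Mapping.single k (c * a)"
  by (rule poly_mapping_eqI) (simp add: lookup_scaleR_poly_mapping lookup_single when_def)

lemma sum_single_keys:
  "(\<Sum>k\<in>Poly_Mapping.keys u. Poly_Mapping.single k (Poly_Mapping.lookup u k)) = u"
  by (rule poly_mapping_eqI)
    (simp add: lookup_sum lookup_single when_def sum.delta in_keys_iff)

lemma free_extend_singles: "free_extend (\<lambda>k. Poly_Mapping.single k 1) u = u"
  by (simp add: free_extend_def scaleR_single sum_single_keys)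

lemma linear_eq_free_extend:
  assumes "linear f"
  shows "f u = free_extend (\<lambda>k. f (Poly_Mapping.single k 1)) u"
proof -
  have "f u = f (free_extend (\<lambda>k. Poly_Mapping.single k 1) u)"
    by (simp add: free_extend_singles)
  then show ?thesis
    by (simp add: free_extend_def linear_sum[OF assms] linear_scale[OF assms])
qed

lemma linear_eqI_single:
  assumes "linear f" "linear g"
    and "\<And>k. f (Poly_Mapping.single k 1) = g (Poly_Mapping.single k (1 :: real))"
  shows "f u = g u"
  using linear_eq_free_extend[OF assms(1), of u] linear_eq_free_extend[OF assms(2), of u]
  by (simp only: assms(3))

lemma single_in_F0: "s \<in> S \<Longrightarrow> Poly_Mapping.single s c \<in> F0 S"
  by (auto simp: F0_iff lookup_single when_def)

section \<open>The tensor product of spaces of finitely supported functions\<close>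

lift_definition outer_product ::
  "('s \<Rightarrow>\<^sub>0 real) \<Rightarrow> ('t \<Rightarrow>\<^sub>0 real) \<Rightarrow> ('s \<times> 't \<Rightarrow>\<^sub>0 real)" is "\<lambda>f g (s, t). f s * g t"
proof -
  fix f :: "'s \<Rightarrow> real" and g :: "'t \<Rightarrow> real"
  assume "finite {s. f s \<noteq> 0}" "finite {t. g t \<noteq> 0}"
  then have "finite ({s. f s \<noteq> 0} \<times> {t. g t \<noteq> 0})"
    by simp
  then show "finite {p. (case p of (s, t) \<Rightarrow> f s * g t) \<noteq> 0}"
    by (rule rev_finite_subset) auto
qed

lemma lookup_outer_product [simp]:
  "Poly_Mapping.lookup (outer_product x y) (s, t) = Poly_Mapping.lookup x s * Poly_Mapping.lookup y t"
  by transfer simp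

lemma linear_outer_product_left: "linear (\<lambda>x. outer_product x y)"
  by (rule linearI; rule poly_mapping_eqI)
    (auto simp: lookup_add lookup_scaleR_poly_mapping algebra_simps)

lemma linear_outer_product_right: "linear (outer_product x)"
  by (rule linearI; rule poly_mapping_eqI)
    (auto simp: lookup_add lookup_scaleR_poly_mapping algebra_simps)

lemma outer_product_single:
  "outer_product (Poly_Mapping.single s a) (Poly_Mapping.single t b) = Poly_Mapping.single (s, t) (a * b)"
  by (rule poly_mapping_eqI) (auto simp: lookup_single when_def split: if_splits)

lemma outer_product_in_F0: "x \<in> F0 S \<Longrightarrow> y \<in> F0 T \<Longrightarrow> outer_product x y \<in> F0 (S \<times> T)"
  by (auto simp: F0_iff)

lemma linear_pure_tensor_left: "linear (\<lambda>x. x \<otimes> y)"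
  by (rule linearI) (simp_all add: pure_tensor_add_left pure_tensor_scaleR_left)

lemma linear_pure_tensor_right: "linear ((\<otimes>) x)"
  by (rule linearI) (simp_all add: pure_tensor_add_right pure_tensor_scaleR_right)

text \<open>Extended linearly by \<open>free_extend\<close>, this family becomes the inverse of the
  isomorphism.\<close>

definition basis_tensor :: "'s \<times> 't \<Rightarrow> ('s \<Rightarrow>\<^sub>0 real, 't \<Rightarrow>\<^sub>0 real) tensor" where
  "basis_tensor = (\<lambda>(s, t). Poly_Mapping.single s 1 \<otimes> Poly_Mapping.single t 1)"

text \<open>Both sides are linear in \<open>x\<close> and in \<open>y\<close>, so comparing them on
  pairs of basis vectors suffices. This is one half of the inverse relation, on pure
  tensors.\<close>

lemma free_extend_outer_product: "free_extend basis_tensor (outer_product x y) = x \<otimes> y"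
proof (rule linear_eqI_single[where f = "\<lambda>x. free_extend basis_tensor (outer_product x y)"])
  show "linear (\<lambda>x. free_extend basis_tensor (outer_product x y))"
    using linear_compose[OF linear_outer_product_left linear_free_extend] by (simp add: o_def)
  show "free_extend basis_tensor (outer_product (Poly_Mapping.single s 1) y)
      = Poly_Mapping.single s 1 \<otimes> y" for s
  proof (rule linear_eqI_single[where
        f = "\<lambda>y. free_extend basis_tensor (outer_product (Poly_Mapping.single s 1) y)"])
    show "linear (\<lambda>y. free_extend basis_tensor (outer_product (Poly_Mapping.single s 1) y))"
      using linear_compose[OF linear_outer_product_right linear_free_extend] by (simp add: o_def)
  qed (simp_all add: linear_pure_tensor_right outer_product_single free_extend_single basis_tensor_def)
qed (rule linear_pure_tensor_left)

lemma free_extend_basis_tensor_in_tensor_space: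
  assumes "u \<in> F0 (S \<times> T)"
  shows "free_extend basis_tensor u \<in> tensor_space (F0 S) (F0 T)"
  unfolding free_extend_def tensor_space_def
proof (rule span_sum, rule span_scale, rule span_base)
  fix k assume "k \<in> Poly_Mapping.keys u"
  then have "k \<in> S \<times> T"
    using assms by (auto simp: F0_def)
  then show "basis_tensor k \<in> {x \<otimes> y |x y. x \<in> F0 S \<and> y \<in> F0 T}"
    by (auto simp: basis_tensor_def intro: single_in_F0)
qed

lemma subspace_tensor_space: "subspace (tensor_space V W)"
  by (simp add: tensor_space_def subspace_span)

text \<open>Serves the uniqueness claim, where the competing map is linear only on a subspace, so
  partial sums must be kept inside it.\<close>

lemma linear_map_on_sum:
  assumes "linear_map_on V f" "subspace V" "\<And>i. i \<in> A \<Longrightarrow> v i \<in> V"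
  shows "f (\<Sum>i\<in>A. c i *\<^sub>R v i) = (\<Sum>i\<in>A. c i *\<^sub>R f (v i))"
proof -
  have "f 0 = 0"
    using assms(1) subspace_0[OF assms(2)] unfolding linear_map_on_def by (metis scaleR_zero_left)
  then show ?thesis
    using assms(3)
  proof (induction A rule: infinite_finite_induct)
    case (insert i A)
    have "(\<Sum>i\<in>A. c i *\<^sub>R v i) \<in> V" "c i *\<^sub>R v i \<in> V"
      using insert.prems assms(2) by (auto intro!: subspace_sum subspace_scale)
    then have "f (\<Sum>j\<in>insert i A. c j *\<^sub>R v j) = f (c i *\<^sub>R v i) + f (\<Sum>j\<in>A. c j *\<^sub>R v j)"
      using insert.hyps assms(1) by (simp add: linear_map_on_def)
    then show ?case
      using insert assms(1) by (simp add: linear_map_on_def)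
  qed simp_all
qed

section \<open>Lexicographic and projective cones\<close>

lemma Lex_cone_negE:
  assumes "f \<in> Lex_cone S" "s \<in> S" "Poly_Mapping.lookup f s < 0"
  obtains t where "t \<in> S" "t < s" "Poly_Mapping.lookup f t > 0"
  using assms unfolding Lex_cone_def by blast

lemma zero_in_Lex_cone: "0 \<in> Lex_cone S"
  by (simp add: Lex_cone_def F0_iff)

lemma Lex_cone_add:
  assumes f: "f \<in> Lex_cone S" and g: "g \<in> Lex_cone S"
  shows "f + g \<in> Lex_cone S"
proof -
  have F0: "f \<in> F0 S" "g \<in> F0 S"
    using f g by (auto simp: Lex_cone_def)
  have "\<exists>t\<in>S. t < s \<and> Poly_Mapping.lookup (f + g) t > 0"
    if s: "s \<in> S" "Poly_Mapping.lookup (f + g) s < 0" for s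
  proof -
    let ?M = "{u \<in> Poly_Mapping.keys f \<union> Poly_Mapping.keys g. u \<le> s}"
    have "s \<in> ?M"
      using s by (auto simp: in_keys_iff lookup_add)
    moreover have "finite ?M"
      by simp
    ultimately obtain u where u: "u \<in> ?M" "\<And>v. v \<in> ?M \<Longrightarrow> v \<le> u \<Longrightarrow> u = v"
      using finite_has_minimal[of ?M] by blast
    have "u \<in> S"
      using u(1) F0 by (auto simp: F0_def)
    \<comment> \<open>A negative value of \<open>h\<close> at \<open>u\<close> would require a
      positive one at some \<open>v < u\<close>, and this \<open>v\<close> lies in
      \<open>?M\<close>, against minimality. The generic \<open>h\<close> covers both
      \<open>f\<close> and \<open>g\<close>.\<close>
    have nonneg: "Poly_Mapping.lookup h u \<ge> 0"
      if h: "h \<in> Lex_cone S" "Poly_Mapping.keys h \<subseteq> Poly_Mapping.keys f \<union> Poly_Mapping.keys g" for h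
    proof (rule ccontr)
      assume "\<not> Poly_Mapping.lookup h u \<ge> 0"
      then obtain v where v: "v < u" "Poly_Mapping.lookup h v > 0"
        using Lex_cone_negE[OF h(1) \<open>u \<in> S\<close>] by (auto simp: not_le)
      then have "v \<in> Poly_Mapping.keys h"
        by (simp add: in_keys_iff)
      then have "v \<in> ?M"
        using h(2) v(1) u(1) by auto
      from u(2)[OF this less_imp_le[OF v(1)]] v(1) show False
        by simp
    qed
    have "Poly_Mapping.lookup f u \<noteq> 0 \<or> Poly_Mapping.lookup g u \<noteq> 0"
      using u(1) by (auto simp: in_keys_iff)
    then have pos: "Poly_Mapping.lookup (f + g) u > 0"
      using nonneg[OF f] nonneg[OF g] by (auto simp: lookup_add)
    \<comment> \<open>The sum is positive at \<open>u\<close> and negative at \<open>s\<close>, so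
      the two points differ.\<close>
    with s u(1) have "u < s"
      by (auto simp: order.strict_iff_order)
    then show ?thesis
      using pos \<open>u \<in> S\<close> by blast
  qed
  then show ?thesis
    using subspace_add[OF subspace_F0 F0] by (simp add: Lex_cone_def)
qed

lemma single_in_Lex_cone: "s \<in> S \<Longrightarrow> 0 \<le> a \<Longrightarrow> Poly_Mapping.single s a \<in> Lex_cone S"
  by (auto simp: Lex_cone_def single_in_F0 lookup_single when_def)

text \<open>Only the value at \<open>s\<close> can be negative, and the positive value at
  \<open>t\<close> lies below it. The cone compares signs only, so no bound on \<open>b\<close> in
  terms of \<open>a\<close> arises.\<close>

lemma single_diff_in_Lex_cone:
  assumes "s \<in> S" "t \<in> S" "t < s" "0 < a"
  shows "Poly_Mapping.single t a - Poly_Mapping.single s b \<in> Lex_cone S"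
proof -
  have "Poly_Mapping.single t a - Poly_Mapping.single s b \<in> F0 S"
    using assms by (intro subspace_diff[OF subspace_F0] single_in_F0)
  then show ?thesis
    using assms by (auto simp: Lex_cone_def lookup_minus lookup_single when_def)
qed

lemma outer_product_in_Lex_cone:
  assumes "x \<in> Lex_cone S" "y \<in> Lex_cone T"
  shows "outer_product x y \<in> Lex_cone (S \<times> T)"
proof -
  have "\<exists>q\<in>S \<times> T. q < (s, t) \<and> Poly_Mapping.lookup (outer_product x y) q > 0"
    if "s \<in> S" "t \<in> T" "Poly_Mapping.lookup x s * Poly_Mapping.lookup y t < 0" for s t
    using that(3) unfolding mult_less_0_iff
  proof (elim disjE conjE)
    assume "0 < Poly_Mapping.lookup x s" "Poly_Mapping.lookup y t < 0"
    moreover from this(2) obtain t' where "t' \<in> T" "t' < t" "Poly_Mapping.lookup y t' > 0"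
      using Lex_cone_negE[OF assms(2) \<open>t \<in> T\<close>] by blast
    ultimately show ?thesis
      using that(1) by (intro bexI[of _ "(s, t')"]) (auto simp: order.strict_iff_order[of "(s, t')"])
  next
    assume "Poly_Mapping.lookup x s < 0" "0 < Poly_Mapping.lookup y t"
    moreover from this(1) obtain s' where "s' \<in> S" "s' < s" "Poly_Mapping.lookup x s' > 0"
      using Lex_cone_negE[OF assms(1) \<open>s \<in> S\<close>] by blast
    ultimately show ?thesis
      using that(2) by (intro bexI[of _ "(s', t)"]) (auto simp: order.strict_iff_order[of "(s', t)"])
  qed
  then show ?thesis
    using assms outer_product_in_F0[of x S y T] by (auto simp: Lex_cone_def)
qed

text \<open>Induction on the number of points with negative value: subtracting a suitable two-point
  generator removes one of them and stays in the cone. Once none is left, the function is a sum of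
  positive point masses.\<close>

lemma Lex_cone_induct [consumes 1, case_names zero add single diff]:
  assumes "f \<in> Lex_cone S"
    and zero: "P 0"
    and add: "\<And>g h. P g \<Longrightarrow> P h \<Longrightarrow> P (g + h)"
    and single: "\<And>s a. s \<in> S \<Longrightarrow> a > 0 \<Longrightarrow> P (Poly_Mapping.single s a)"
    and diff: "\<And>s t a b. s \<in> S \<Longrightarrow> t \<in> S \<Longrightarrow> t < s \<Longrightarrow> a > 0 \<Longrightarrow> b > 0 \<Longrightarrow>
      P (Poly_Mapping.single t a - Poly_Mapping.single s b)"
  shows "P f"
  using assms(1)
proof (induction "card {s. Poly_Mapping.lookup f s < 0}" arbitrary: f rule: less_induct)
  case less
  have fin: "finite {s. Poly_Mapping.lookup f s < 0}"
    by (rule finite_subset[OF _ finite_keys[of f]]) (auto simp: in_keys_iff)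
  have F0: "f \<in> F0 S"
    using less.prems by (simp add: Lex_cone_def)
  show ?case
  proof (cases "\<exists>s. Poly_Mapping.lookup f s < 0")
    case False
    have "P (\<Sum>k\<in>A. Poly_Mapping.single k (Poly_Mapping.lookup f k))"
      if "finite A" "A \<subseteq> Poly_Mapping.keys f" for A
      using that
    proof (induction rule: finite_induct)
      case (insert k A)
      have "Poly_Mapping.lookup f k \<ge> 0" "Poly_Mapping.lookup f k \<noteq> 0" "k \<in> S"
        using insert.prems F0 False by (auto simp: F0_def in_keys_iff not_less)
      then show ?case
        using insert by (simp add: add single)
    qed (simp add: zero)
    from this[of "Poly_Mapping.keys f"] show ?thesis
      by (simp add: sum_single_keys)
  next
    case True
    then obtain s where s: "Poly_Mapping.lookup f s < 0" ..
    then have "s \<in> S"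
      using F0 by (force simp: F0_iff)
    then obtain t where t: "t \<in> S" "t < s" "Poly_Mapping.lookup f t > 0"
      using Lex_cone_negE[OF less.prems] s by blast
    \<comment> \<open>Subtracting \<open>d\<close> cancels the value at \<open>s\<close> exactly.
      Only half of the value at \<open>t\<close> is spent, so \<open>t\<close> stays positive and
      still serves as a witness below other negative points.\<close>
    define d where "d = Poly_Mapping.single t (Poly_Mapping.lookup f t / 2)
      - Poly_Mapping.single s (- Poly_Mapping.lookup f s)"
    have "P d"
      unfolding d_def using s t \<open>s \<in> S\<close> by (intro diff) auto
    have lookup: "Poly_Mapping.lookup (f - d) k =
      (if k = s then 0 else if k = t then Poly_Mapping.lookup f t / 2 else Poly_Mapping.lookup f k)" for k
      using t(2) by (auto simp: d_def lookup_minus lookup_single when_def)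
    have "{k. Poly_Mapping.lookup (f - d) k < 0} \<subset> {k. Poly_Mapping.lookup f k < 0}"
      using s t by (auto simp: lookup split: if_splits)
    then have card: "card {k. Poly_Mapping.lookup (f - d) k < 0} < card {k. Poly_Mapping.lookup f k < 0}"
      by (rule psubset_card_mono[OF fin])
    have "f - d \<in> F0 S"
      using F0 t(1) \<open>s \<in> S\<close> by (auto simp: F0_iff lookup)
    moreover have "\<exists>v\<in>S. v < k \<and> Poly_Mapping.lookup (f - d) v > 0"
      if k: "k \<in> S" "Poly_Mapping.lookup (f - d) k < 0" for k
    proof -
      have "Poly_Mapping.lookup f k < 0"
        using k(2) t(3) by (auto simp: lookup split: if_splits)
      then obtain v where "v \<in> S" "v < k" "Poly_Mapping.lookup f v > 0"
        using Lex_cone_negE[OF less.prems k(1)] by blast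
      \<comment> \<open>The old witness survives: \<open>v\<close> is not \<open>s\<close>, where
        \<open>f\<close> is negative, and if \<open>v = t\<close> half of its value remains.\<close>
      then show ?thesis
        using s by (intro bexI[of _ v]) (auto simp: lookup)
    qed
    ultimately have "f - d \<in> Lex_cone S"
      by (simp add: Lex_cone_def)
    then have "P (f - d + d)"
      using add less.hyps[OF card] \<open>P d\<close> by blast
    then show ?thesis
      by simp
  qed
qed

section \<open>Sums in the projective cone\<close>

lemma zero_in_projective_cone: "0 \<in> projective_cone C D"
  unfolding projective_cone_def by (intro CollectI exI[of _ 0]) simp

lemma projective_cone_add_pure:
  assumes "z \<in> projective_cone C D" "v \<in> C" "w \<in> D"
  shows "z + v \<otimes> w \<in> projective_cone C D"
proof -
  obtain n :: nat and x y where z: "z = (\<Sum>i<n. x i \<otimes> y i)" and "\<forall>i<n. x i \<in> C" "\<forall>i<n. y i \<in> D"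
    using assms(1) unfolding projective_cone_def by blast
  \<comment> \<open>The new tensor takes index \<open>n\<close>; the updates leave all earlier
    summands unchanged.\<close>
  then have "\<forall>i<Suc n. (x(n := v)) i \<in> C" "\<forall>i<Suc n. (y(n := w)) i \<in> D"
    using assms by (auto simp: less_Suc_eq)
  moreover have "z + v \<otimes> w = (\<Sum>i<Suc n. (x(n := v)) i \<otimes> (y(n := w)) i)"
    by (simp add: z)
  ultimately show ?thesis
    unfolding projective_cone_def by blast
qed

lemma pure_in_projective_cone: "v \<in> C \<Longrightarrow> w \<in> D \<Longrightarrow> v \<otimes> w \<in> projective_cone C D"
  using projective_cone_add_pure[OF zero_in_projective_cone] by fastforce

lemma projective_cone_add:
  assumes "z \<in> projective_cone C D" "z' \<in> projective_cone C D"
  shows "z + z' \<in> projective_cone C D"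
proof -
  obtain n :: nat and x y where z': "z' = (\<Sum>i<n. x i \<otimes> y i)" and C: "\<forall>i<n. x i \<in> C" and D: "\<forall>i<n. y i \<in> D"
    using assms(2) unfolding projective_cone_def by blast
  have "m \<le> n \<Longrightarrow> z + (\<Sum>i<m. x i \<otimes> y i) \<in> projective_cone C D" for m
  proof (induction m)
    case (Suc m)
    then show ?case
      using projective_cone_add_pure[of "z + (\<Sum>i<m. x i \<otimes> y i)" C D "x m" "y m"] C D
      by (simp add: add.assoc)
  qed (simp add: assms(1))
  then show ?thesis
    by (simp add: z')
qed

lemma free_extend_Lex_cone_in_projective_cone:
  fixes S :: "'s::order set" and T :: "'t::order set"
  assumes "u \<in> Lex_cone (S \<times> T)"
  shows "free_extend basis_tensor u \<in> projective_cone (Lex_cone S) (Lex_cone T)"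
  using assms
proof (induction rule: Lex_cone_induct)
  case zero
  then show ?case
    by (simp add: linear_0[OF linear_free_extend] zero_in_projective_cone)
next
  case (add g h)
  then show ?case
    by (simp add: linear_add[OF linear_free_extend] projective_cone_add)
next
  case (single p a)
  obtain s t where p: "p = (s, t)"
    by (cases p)
  have "Poly_Mapping.single p a = outer_product (Poly_Mapping.single s a) (Poly_Mapping.single t 1)"
    by (simp add: p outer_product_single)
  then show ?case
    using single by (auto simp: p free_extend_outer_product
        intro!: pure_in_projective_cone single_in_Lex_cone)
next
  case (diff p q a b)
  obtain s t s' t' where p: "p = (s, t)" and q: "q = (s', t')"
    by (cases p; cases q)
  have mem: "s \<in> S" "t \<in> T" "s' \<in> S" "t' \<in> T" and le: "s' \<le> s" "t' \<le> t"
    using diff by (auto simp: p q less_prod_def)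
  let ?e = Poly_Mapping.single
  show ?case
  \<comment> \<open>The corner decomposition fails for \<open>s' = s\<close>: its first factor would
    be the point mass \<open>a - b\<close> at \<open>s\<close>, which is outside the cone if
    \<open>a < b\<close>.\<close>
  proof (cases "s' = s")
    case True
    have "?e q a - ?e p b = outer_product (?e s 1) (?e t' a - ?e t b)"
      by (simp add: p q True outer_product_single linear_diff[OF linear_outer_product_right])
    moreover have "t' < t"
      using diff(3) le True by (auto simp: p q order.strict_iff_order)
    ultimately show ?thesis
      using mem diff
      by (auto simp: free_extend_outer_product
          intro!: pure_in_projective_cone single_in_Lex_cone single_diff_in_Lex_cone)
  next
    case s: False
    have left: "?e s' a - ?e s b \<in> Lex_cone S"
      using s le mem diff by (intro single_diff_in_Lex_cone) auto
    \<comment> \<open>The coefficient \<open>b\<close> on \<open>t'\<close> makes the two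
      contributions at the corner \<open>(s, t')\<close> cancel. If \<open>t' = t\<close>, this
      factor is zero.\<close>
    have right: "?e t' b - ?e t b \<in> Lex_cone T"
    proof (cases "t' = t")
      case False
      then show ?thesis
        using le mem diff by (intro single_diff_in_Lex_cone) auto
    qed (simp add: zero_in_Lex_cone)
    have "?e q a - ?e p b = outer_product (?e s' a - ?e s b) (?e t' 1)
      + outer_product (?e s 1) (?e t' b - ?e t b)"
      by (simp add: p q outer_product_single linear_diff[OF linear_outer_product_right]
          linear_diff[OF linear_outer_product_left])
    then show ?thesis
      using left right mem
      by (auto simp: linear_add[OF linear_free_extend] free_extend_outer_product
          intro!: projective_cone_add pure_in_projective_cone single_in_Lex_cone)
  qed
qed

section \<open>The isomorphism, its uniqueness and the image of the projective cone\<close>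

theorem proposition4p2:
  fixes S :: "'s::order set" and T :: "'t::order set"
  shows "\<exists>\<Phi> :: ('s \<Rightarrow>\<^sub>0 real, 't \<Rightarrow>\<^sub>0 real) tensor \<Rightarrow> ('s \<times> 't \<Rightarrow>\<^sub>0 real).
      (linear_map_on (tensor_space (F0 S) (F0 T)) \<Phi> \<and>
       (\<forall>s\<in>S. \<forall>t\<in>T. \<Phi> (Poly_Mapping.single s 1 \<otimes> Poly_Mapping.single t 1)
                       = Poly_Mapping.single (s, t) 1)) \<and>
      (\<forall>\<Psi> :: ('s \<Rightarrow>\<^sub>0 real, 't \<Rightarrow>\<^sub>0 real) tensor \<Rightarrow> ('s \<times> 't \<Rightarrow>\<^sub>0 real).
         linear_map_on (tensor_space (F0 S) (F0 T)) \<Psi> \<and>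
         (\<forall>s\<in>S. \<forall>t\<in>T. \<Psi> (Poly_Mapping.single s 1 \<otimes> Poly_Mapping.single t 1)
                         = Poly_Mapping.single (s, t) 1)
         \<longrightarrow> (\<forall>z\<in>tensor_space (F0 S) (F0 T). \<Psi> z = \<Phi> z)) \<and>
      bij_betw \<Phi> (tensor_space (F0 S) (F0 T)) (F0 (S \<times> T)) \<and>
      \<Phi> ` projective_cone (Lex_cone S) (Lex_cone T) = Lex_cone (S \<times> T)"
proof -
  let ?E = "tensor_space (F0 S) (F0 T)"
  let ?G = "free_extend basis_tensor"
  \<comment> \<open>The map is built on the tensor product of the ambient spaces and only then
    restricted to \<open>?E\<close>.\<close>
  have "\<exists>h. linear h \<and> (\<forall>(x :: 's \<Rightarrow>\<^sub>0 real) (y :: 't \<Rightarrow>\<^sub>0 real). h (x \<otimes> y) = outer_product x y)"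
    by (rule tensor_universal[OF linear_outer_product_left linear_outer_product_right])
  then obtain \<Phi> :: "('s \<Rightarrow>\<^sub>0 real, 't \<Rightarrow>\<^sub>0 real) tensor \<Rightarrow> ('s \<times> 't \<Rightarrow>\<^sub>0 real)"
    where lin: "linear \<Phi>" and pure: "\<And>x y. \<Phi> (x \<otimes> y) = outer_product x y"
    by blast
  have \<Phi>G: "\<Phi> (?G u) = u" for u
  proof (rule linear_eqI_single[where f = "\<lambda>u. \<Phi> (?G u)" and g = "\<lambda>u. u"])
    show "linear (\<lambda>u. \<Phi> (?G u))"
      using linear_compose[OF linear_free_extend lin] by (simp add: o_def)
  qed (auto simp: linear_ident free_extend_single basis_tensor_def pure outer_product_single)
  have G\<Phi>: "?G (\<Phi> z) = z" and \<Phi>_F0: "\<Phi> z \<in> F0 (S \<times> T)" if "z \<in> ?E" for z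
  proof -
    have "?G (\<Phi> z) = z \<and> \<Phi> z \<in> F0 (S \<times> T)"
      using that unfolding tensor_space_def
    proof (induction rule: span_induct_alt)
      case base
      then show ?case
        by (simp add: linear_0[OF lin] linear_0[OF linear_free_extend] subspace_0[OF subspace_F0])
    next
      case (step c v z)
      obtain x y where v: "v = x \<otimes> y" "x \<in> F0 S" "y \<in> F0 T"
        using step by blast
      have "\<Phi> v \<in> F0 (S \<times> T)" "?G (\<Phi> v) = v"
        using v by (auto simp: pure free_extend_outer_product intro: outer_product_in_F0)
      then show ?case
        using step by (simp add: linear_add[OF lin] linear_scale[OF lin]
            linear_add[OF linear_free_extend] linear_scale[OF linear_free_extend]
            subspace_add[OF subspace_F0] subspace_scale[OF subspace_F0])
    qed
    then show "?G (\<Phi> z) = z" "\<Phi> z \<in> F0 (S \<times> T)"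
      by auto
  qed
  have "linear_map_on ?E \<Phi>"
    by (simp add: linear_map_on_def linear_add[OF lin] linear_scale[OF lin])
  moreover have "\<forall>s\<in>S. \<forall>t\<in>T. \<Phi> (Poly_Mapping.single s 1 \<otimes> Poly_Mapping.single t 1)
      = Poly_Mapping.single (s, t) 1"
    by (simp add: pure outer_product_single)
  moreover have "\<Psi> z = \<Phi> z"
    if \<Psi>: "linear_map_on ?E \<Psi>" "\<forall>s\<in>S. \<forall>t\<in>T. \<Psi> (Poly_Mapping.single s 1 \<otimes> Poly_Mapping.single t 1)
      = Poly_Mapping.single (s, t) 1" and z: "z \<in> ?E" for \<Psi> z
  proof -
    let ?K = "Poly_Mapping.keys (\<Phi> z)"
    have K: "?K \<subseteq> S \<times> T"
      using \<Phi>_F0[OF z] by (simp add: F0_def)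
    have mem: "basis_tensor k \<in> ?E" if "k \<in> ?K" for k
      using that K free_extend_basis_tensor_in_tensor_space[OF single_in_F0, of k S T 1]
      by (auto simp: free_extend_single)
    \<comment> \<open>Rewriting \<open>z\<close> this way expands it in basis tensors from
      \<open>?E\<close>, the only tensors on which the values of \<open>\<Psi>\<close> are
      prescribed.\<close>
    have "\<Psi> z = \<Psi> (?G (\<Phi> z))"
      by (simp add: G\<Phi> z)
    also have "\<dots> = (\<Sum>k\<in>?K. Poly_Mapping.lookup (\<Phi> z) k *\<^sub>R \<Psi> (basis_tensor k))"
      unfolding free_extend_def by (rule linear_map_on_sum[OF \<Psi>(1) subspace_tensor_space mem])
    also have "\<dots> = (\<Sum>k\<in>?K. Poly_Mapping.lookup (\<Phi> z) k *\<^sub>R Poly_Mapping.single k 1)"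
      using K \<Psi>(2) by (intro sum.cong) (auto simp: basis_tensor_def)
    also have "\<dots> = \<Phi> z"
      by (simp add: scaleR_single sum_single_keys)
    finally show ?thesis .
  qed
  moreover have "bij_betw \<Phi> ?E (F0 (S \<times> T))"
    by (rule bij_betw_byWitness[where f' = ?G])
      (auto simp: G\<Phi> \<Phi>G \<Phi>_F0 free_extend_basis_tensor_in_tensor_space)
  moreover have "\<Phi> ` projective_cone (Lex_cone S) (Lex_cone T) = Lex_cone (S \<times> T)"
  proof (intro equalityI subsetI)
    fix u assume "u \<in> \<Phi> ` projective_cone (Lex_cone S) (Lex_cone T)"
    then obtain n :: nat and x y where u: "u = (\<Sum>i<n. outer_product (x i) (y i))"
      and xy: "\<forall>i<n. x i \<in> Lex_cone S" "\<forall>i<n. y i \<in> Lex_cone T"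
      by (auto simp: projective_cone_def linear_sum[OF lin] pure)
    have "m \<le> n \<Longrightarrow> (\<Sum>i<m. outer_product (x i) (y i)) \<in> Lex_cone (S \<times> T)" for m
      by (induction m) (use xy in \<open>auto simp: zero_in_Lex_cone intro!: Lex_cone_add outer_product_in_Lex_cone\<close>)
    then show "u \<in> Lex_cone (S \<times> T)"
      by (simp add: u)
  next
    fix u assume "u \<in> Lex_cone (S \<times> T)"
    then have "?G u \<in> projective_cone (Lex_cone S) (Lex_cone T)"
      by (rule free_extend_Lex_cone_in_projective_cone)
    then show "u \<in> \<Phi> ` projective_cone (Lex_cone S) (Lex_cone T)"
      \<comment> \<open>The preimage of \<open>u\<close> is \<open>?G u\<close>.\<close>
      by (metis \<Phi>G imageI)
  qed
  ultimately show ?thesis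
    by blast
qed

end
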